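(* For every integer $k\ge3$, every satellite graph $G=S_{2k+1}$ has all of the following properties: (1) $G$ is a core graph; (2) $0$ is a main eigenvalue of $A_G$; (3) every vertex of $G$ lies on a triangle; (4) for every vertex $u$ and every $w\in N(u)$, the vertices $u,w$ lie on a common triangle; (5) $G$ is not regular; (6) $G$ is connected; (7) $G$ is not bipartite; (8) the diameter of $G$ is $2$ or $3$.
   Context: For an integer $k\ge3$, a satellite graph $S_{2k+1}$ is a simple graph on $2k+1$ vertices whose vertex set is partitioned into a single vertex $v_{\mathrm{dom}}$, a set $V_4=\{u_1,\dots,u_k\}$ and a set $V_2=\{w_1,\dots,w_k\}$, with edges: $v_{\mathrm{dom}}$ is adjacent to every other vertex; each vertex of $V_4$ is adjacent to exactly two vertices of $V_4$ and exactly one vertex of $V_2$; each vertex of $V_2$ is adjacent to exactly one vertex of $V_4$ (and to $v_{\mathrm{dom}}$); no other edges. A graph is a core graph if its adjacency matrix has a null vector all of whose entries are nonzero. An eigenvalue of $A_G$ is main if some associated eigenvector is not orthogonal to the all-ones vector. *)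

theory Defs
  imports
    "Graph_Theory.Graph_Theory"
    "Jordan_Normal_Form.Matrix_Kernel"
    "Jordan_Normal_Form.Char_Poly"
begin

text \<open>
  A finite simple graph is a digraph satisfying the locale predicate \<^const>\<open>graph\<close>:
  finite, loop-free, without parallel arcs, and symmetric, so an undirected edge is a pair of
  opposite arcs.
\<close>

definition neighbors :: "('a, 'b) pre_digraph \<Rightarrow> 'a \<Rightarrow> 'a set" where
  "neighbors G u = {v. u \<rightarrow>\<^bsub>G\<^esub> v}"

definition satellite_graph :: "nat \<Rightarrow> ('a, 'b) pre_digraph \<Rightarrow> bool" where
  "satellite_graph k G \<longleftrightarrow> graph G \<and>
    (\<exists>v\<^sub>d\<^sub>o\<^sub>m V\<^sub>4 V\<^sub>2.
       verts G = {v\<^sub>d\<^sub>o\<^sub>m} \<union> V\<^sub>4 \<union> V\<^sub>2 \<and> v\<^sub>d\<^sub>o\<^sub>m \<notin> V\<^sub>4 \<and> v\<^sub>d\<^sub>o\<^sub>m \<notin> V\<^sub>2 \<and> V\<^sub>4 \<inter> V\<^sub>2 = {} \<and>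
       card V\<^sub>4 = k \<and> card V\<^sub>2 = k \<and>
       neighbors G v\<^sub>d\<^sub>o\<^sub>m = verts G - {v\<^sub>d\<^sub>o\<^sub>m} \<and>
       (\<forall>u\<in>V\<^sub>4. card (neighbors G u \<inter> V\<^sub>4) = 2 \<and> card (neighbors G u \<inter> V\<^sub>2) = 1) \<and>
       (\<forall>w\<in>V\<^sub>2. card (neighbors G w \<inter> V\<^sub>4) = 1 \<and> neighbors G w \<inter> V\<^sub>2 = {}))"

text \<open>
  Matrices are indexed by numbers, so the adjacency matrix is taken with respect to a list \<open>vs\<close>
  enumerating the vertices. Properties of ``the'' adjacency matrix are required for every
  enumeration; different enumerations only conjugate the matrix by a permutation.
\<close>

definition vertex_enumeration :: "('a, 'b) pre_digraph \<Rightarrow> 'a list \<Rightarrow> bool" where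
  "vertex_enumeration G vs \<longleftrightarrow> distinct vs \<and> set vs = verts G"

definition adjacency_matrix :: "('a, 'b) pre_digraph \<Rightarrow> 'a list \<Rightarrow> real mat" where
  "adjacency_matrix G vs =
     mat (length vs) (length vs) (\<lambda>(i, j). if vs ! i \<rightarrow>\<^bsub>G\<^esub> vs ! j then 1 else 0)"

definition core_graph :: "('a, 'b) pre_digraph \<Rightarrow> bool" where
  "core_graph G \<longleftrightarrow> graph G \<and>
    (\<forall>vs. vertex_enumeration G vs \<longrightarrow>
      (\<exists>x \<in> mat_kernel (adjacency_matrix G vs). \<forall>i < dim_vec x. x $ i \<noteq> 0))"

definition main_eigenvalue :: "real mat \<Rightarrow> real \<Rightarrow> bool" where
  "main_eigenvalue A \<mu> \<longleftrightarrow>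
    (\<exists>x. eigenvector A x \<mu> \<and> x \<bullet> vec (dim_row A) (\<lambda>_. 1) \<noteq> 0)"

definition triangle :: "('a, 'b) pre_digraph \<Rightarrow> 'a set \<Rightarrow> bool" where
  "triangle G T \<longleftrightarrow> T \<subseteq> verts G \<and> card T = 3 \<and> (\<forall>u\<in>T. \<forall>v\<in>T. u \<noteq> v \<longrightarrow> u \<rightarrow>\<^bsub>G\<^esub> v)"

text \<open>In a symmetric digraph the out-degree is the degree of the undirected graph.\<close>

definition regular :: "('a, 'b) pre_digraph \<Rightarrow> bool" where
  "regular G \<longleftrightarrow> (\<exists>r. \<forall>v\<in>verts G. out_degree G v = r)"

definition bipartite :: "('a, 'b) pre_digraph \<Rightarrow> bool" where
  "bipartite G \<longleftrightarrow> (\<exists>X Y. verts G = X \<union> Y \<and> X \<inter> Y = {} \<and>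
     (\<forall>u v. u \<rightarrow>\<^bsub>G\<^esub> v \<longrightarrow> u \<in> X \<and> v \<in> Y \<or> u \<in> Y \<and> v \<in> X))"

text \<open>
  With unit arc weights, \<^const>\<open>wf_digraph.\<mu>\<close> is the length of a shortest walk
  (\<open>\<infinity>\<close> if there is none).
\<close>

definition graph_diameter :: "('a, 'b) pre_digraph \<Rightarrow> ereal" where
  "graph_diameter G = (SUP u\<in>verts G. SUP v\<in>verts G. wf_digraph.\<mu> G (\<lambda>_. 1) u v)"

end

theory Submission
  imports Defs
begin

text \<open>
  Put weight \<open>-1\<close> on the vertices of \<open>V\<^sub>4\<close> and weight \<open>1\<close> on all others. The neighbourhood sums are
  \<open>-k + k\<close> at the dominating vertex, \<open>1 - 2 + 1\<close> on \<open>V\<^sub>4\<close> and \<open>1 - 1\<close> on \<open>V\<^sub>2\<close>, so this is a nowhere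
  zero null vector, of total weight \<open>1\<close>. Everything else comes from the dominating vertex: it forms a
  triangle with every edge avoiding it, and it joins any two vertices by a walk of length two. The
  diameter is exactly two because \<open>V\<^sub>2\<close> is independent.
\<close>

section \<open>Adjacency matrices and distances\<close>

text \<open>Turns index sums from matrix products into sums over vertices, so that all later
  computations are free of the enumeration.\<close>

lemma sum_list_enumeration:
  assumes "vertex_enumeration G vs"
  shows "(\<Sum>j<length vs. f (vs ! j)) = sum f (verts G)"
  using assms sum.reindex_bij_betw[OF bij_betw_nth[of vs "{..<length vs}" "verts G"], of f]
  by (auto simp: vertex_enumeration_def)

lemma (in wf_digraph) neighbors_subset_verts: "neighbors G u \<subseteq> verts G"
  by (auto simp: neighbors_def dest: adj_in_verts)

lemma (in fin_digraph) adjacency_matrix_mult_vec: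
  assumes "vertex_enumeration G vs" "i < length vs"
  shows "(adjacency_matrix G vs *\<^sub>v vec (length vs) (\<lambda>j. f (vs ! j))) $ i = sum f (neighbors G (vs ! i))"
proof -
  have "(adjacency_matrix G vs *\<^sub>v vec (length vs) (\<lambda>j. f (vs ! j))) $ i
      = (\<Sum>j<length vs. (\<lambda>v. if v \<in> neighbors G (vs ! i) then f v else 0) (vs ! j))"
    using assms(2) unfolding adjacency_matrix_def
    by (auto simp: scalar_prod_def neighbors_def lessThan_atLeast0 intro!: sum.cong)
  also have "\<dots> = (\<Sum>v\<in>verts G. if v \<in> neighbors G (vs ! i) then f v else 0)"
    using assms(1) by (rule sum_list_enumeration)
  also have "\<dots> = sum f (verts G \<inter> neighbors G (vs ! i))"
    by (simp add: sum.inter_restrict)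
  also have "verts G \<inter> neighbors G (vs ! i) = neighbors G (vs ! i)"
    using neighbors_subset_verts by blast
  finally show ?thesis .
qed

text \<open>The condition on \<open>f\<close> speaks of the graph alone, so a single weight function
  serves every enumeration \<open>vs\<close>.\<close>

lemma (in fin_digraph) vec_in_kernel_adjacency_matrix:
  assumes "vertex_enumeration G vs" "\<And>u. u \<in> verts G \<Longrightarrow> sum f (neighbors G u) = 0"
  shows "vec (length vs) (\<lambda>j. f (vs ! j)) \<in> mat_kernel (adjacency_matrix G vs)"
proof (rule mat_kernelI)
  show "adjacency_matrix G vs \<in> carrier_mat (length vs) (length vs)"
    by (simp add: adjacency_matrix_def)
  have "vs ! i \<in> verts G" if "i < length vs" for i
    using assms(1) that nth_mem by (force simp: vertex_enumeration_def)
  then show "adjacency_matrix G vs *\<^sub>v vec (length vs) (\<lambda>j. f (vs ! j)) = 0\<^sub>v (length vs)"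
    using adjacency_matrix_mult_vec[OF assms(1)] assms(2)
    by (intro eq_vecI) (auto simp: adjacency_matrix_def)
qed simp

lemma (in graph) core_graphI:
  fixes f :: "'a \<Rightarrow> real"
  assumes "\<And>u. u \<in> verts G \<Longrightarrow> f u \<noteq> 0" "\<And>u. u \<in> verts G \<Longrightarrow> sum f (neighbors G u) = 0"
  shows "core_graph G"
  unfolding core_graph_def
proof (intro conjI allI impI)
  show "graph G" by unfold_locales
next
  fix vs assume vs: "vertex_enumeration G vs"
  then have "f (vs ! i) \<noteq> 0" if "i < length vs" for i
    using assms(1) that nth_mem by (force simp: vertex_enumeration_def)
  then show "\<exists>x\<in>mat_kernel (adjacency_matrix G vs). \<forall>i<dim_vec x. x $ i \<noteq> 0"
    by (intro bexI[OF _ vec_in_kernel_adjacency_matrix[OF vs assms(2)]]) auto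
qed

lemma (in fin_digraph) main_eigenvalue_0I:
  fixes f :: "'a \<Rightarrow> real"
  assumes vs: "vertex_enumeration G vs"
    and null: "\<And>u. u \<in> verts G \<Longrightarrow> sum f (neighbors G u) = 0"
    and total: "sum f (verts G) \<noteq> 0"
  shows "main_eigenvalue (adjacency_matrix G vs) 0"
proof -
  let ?x = "vec (length vs) (\<lambda>j. f (vs ! j))" and ?A = "adjacency_matrix G vs"
  have A: "?A \<in> carrier_mat (length vs) (length vs)"
    by (simp add: adjacency_matrix_def)
  have "?x \<bullet> vec (dim_row ?A) (\<lambda>_. 1) = sum f (verts G)"
    using sum_list_enumeration[OF vs, of f]
    by (simp add: scalar_prod_def lessThan_atLeast0 adjacency_matrix_def)
  then have ne: "?x \<bullet> vec (dim_row ?A) (\<lambda>_. 1) \<noteq> 0"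
    using total by simp
  \<comment> \<open>The zero vector is orthogonal to the all-ones vector, so the nonzero total
    already makes \<open>?x\<close> an admissible eigenvector.\<close>
  then have "?x \<noteq> 0\<^sub>v (dim_row ?A)"
    by auto
  moreover have "?A *\<^sub>v ?x = 0 \<cdot>\<^sub>v ?x"
    using mat_kernelD[OF A vec_in_kernel_adjacency_matrix[OF vs null]] by auto
  ultimately show ?thesis
    using ne A unfolding main_eigenvalue_def eigenvector_def by (intro exI[of _ ?x]) auto
qed

text \<open>Without parallel arcs, \<open>head\<close> is injective on the arcs leaving
  \<open>u\<close>.\<close>

lemma (in nomulti_digraph) out_degree_eq_card_neighbors:
  "out_degree G u = card (neighbors G u)"
proof -
  have "inj_on (head G) (out_arcs G u)"
    by (auto simp: inj_on_def arc_to_ends_def intro!: no_multi_arcs)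
  moreover have "head G ` out_arcs G u = neighbors G u"
    by (auto simp: neighbors_def arcs_ends_conv)
  ultimately show ?thesis
    by (metis out_degree_def card_image)
qed

section \<open>Distances for unit arc weights\<close>

lemma (in wf_digraph) \<mu>_le_1:
  assumes "u \<rightarrow>\<^bsub>G\<^esub> v"
  shows "\<mu> (\<lambda>_. 1) u v \<le> 1"
proof -
  obtain e where "e \<in> arcs G" "tail G e = u" "head G e = v"
    using assms by blast
  then have "awalk u [e] v"
    using arc_implies_awalk by blast
  from min_cost_le_walk_cost[OF this, of "\<lambda>_. 1"] show ?thesis
    by (simp add: one_ereal_def)
qed

lemma (in wf_digraph) \<mu>_le_2:
  assumes "u \<rightarrow>\<^bsub>G\<^esub> v" "v \<rightarrow>\<^bsub>G\<^esub> w"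
  shows "\<mu> (\<lambda>_. 1) u w \<le> 2"
proof -
  obtain e e' where "e \<in> arcs G" "tail G e = u" "head G e = v"
    "e' \<in> arcs G" "tail G e' = v" "head G e' = w"
    using assms by blast
  then have "awalk u [e, e'] w"
    by (auto simp: awalk_simps)
  from min_cost_le_walk_cost[OF this, of "\<lambda>_. 1"] show ?thesis
    by simp
qed

text \<open>The distance is an infimum, so it suffices to bound each walk: length 0 would force
  \<open>u = v\<close>, and length 1 would be an arc from \<open>u\<close> to
  \<open>v\<close>.\<close>

lemma (in wf_digraph) \<mu>_ge_2:
  assumes "u \<noteq> v" "\<not> u \<rightarrow>\<^bsub>G\<^esub> v"
  shows "2 \<le> \<mu> (\<lambda>_. 1) u v"
  unfolding \<mu>_def
proof (rule INF_greatest)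
  fix p assume "p \<in> {p. awalk u p v}"
  then have p: "awalk u p v" by simp
  have "length p \<noteq> 0"
    using p assms(1) by (auto simp: awalk_Nil_iff)
  moreover have "length p \<noteq> 1"
    using p assms(2) by (auto simp: length_Suc_conv awalk_simps arcs_ends_conv)
  ultimately have "2 \<le> length p" by linarith
  moreover have "awalk_cost (\<lambda>_. 1) p = length p"
    by (simp add: awalk_cost_def sum_list_triv)
  ultimately show "2 \<le> ereal (awalk_cost (\<lambda>_. 1) p)"
    by simp
qed

section \<open>Triangles and bipartiteness\<close>

lemma edge_iff_neighbors: "u \<rightarrow>\<^bsub>G\<^esub> v \<longleftrightarrow> v \<in> neighbors G u"
  by (simp add: neighbors_def)

text \<open>One arc per side is enough: symmetry supplies the reverse arcs, and the absence of loops
  makes the three vertices distinct.\<close>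

lemma (in graph) triangleI:
  assumes "u \<rightarrow>\<^bsub>G\<^esub> v" "v \<rightarrow>\<^bsub>G\<^esub> w" "u \<rightarrow>\<^bsub>G\<^esub> w"
  shows "triangle G {u, v, w}"
proof -
  have "v \<rightarrow>\<^bsub>G\<^esub> u" "w \<rightarrow>\<^bsub>G\<^esub> v" "w \<rightarrow>\<^bsub>G\<^esub> u"
    using assms arcs_ends_symmetric[OF sym_arcs] by blast+
  moreover have "u \<noteq> v" "v \<noteq> w" "u \<noteq> w"
    using assms adj_not_same by blast+
  ultimately show ?thesis
    using assms by (auto simp: triangle_def dest: adj_in_verts)
qed

text \<open>Two of the three vertices would lie in the same class, yet they are adjacent.\<close>

lemma triangle_imp_not_bipartite:
  assumes "triangle G T"
  shows "\<not> bipartite G"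
proof
  assume "bipartite G"
  then obtain X Y where XY: "X \<inter> Y = {}"
    and edge: "\<And>u v. u \<rightarrow>\<^bsub>G\<^esub> v \<Longrightarrow> u \<in> X \<and> v \<in> Y \<or> u \<in> Y \<and> v \<in> X"
    unfolding bipartite_def by blast
  from assms obtain a b c where T: "T = {a, b, c}" "a \<noteq> b" "b \<noteq> c" "a \<noteq> c"
    unfolding triangle_def card_3_iff by blast
  then have "a \<rightarrow>\<^bsub>G\<^esub> b" "b \<rightarrow>\<^bsub>G\<^esub> c" "a \<rightarrow>\<^bsub>G\<^esub> c"
    using assms by (auto simp: triangle_def)
  then show False
    using XY by (blast dest: edge)
qed

section \<open>Satellite graphs\<close>

text \<open>The partition, existentially quantified in \<open>satellite_graph\<close>, becomes a
  parameter here so that its parts can be named. Positivity of \<open>k\<close> makes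
  \<open>V\<^sub>2\<close> nonempty; the lemmas on regularity and diameter ask for
  \<open>1 < k\<close>.\<close>

locale satellite = graph G for G :: "('a, 'b) pre_digraph" (structure) +
  fixes k :: nat and d :: 'a and V\<^sub>4 V\<^sub>2 :: "'a set"
  assumes k_pos: "0 < k"
    and verts_eq: "verts G = {d} \<union> V\<^sub>4 \<union> V\<^sub>2"
    and d_notin: "d \<notin> V\<^sub>4" "d \<notin> V\<^sub>2"
    and disjoint: "V\<^sub>4 \<inter> V\<^sub>2 = {}"
    and card_parts: "card V\<^sub>4 = k" "card V\<^sub>2 = k"
    and neighbors_d: "neighbors G d = verts G - {d}"
    and card_neighbors_V\<^sub>4: "u \<in> V\<^sub>4 \<Longrightarrow> card (neighbors G u \<inter> V\<^sub>4) = 2"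
      "u \<in> V\<^sub>4 \<Longrightarrow> card (neighbors G u \<inter> V\<^sub>2) = 1"
    and card_neighbors_V\<^sub>2: "w \<in> V\<^sub>2 \<Longrightarrow> card (neighbors G w \<inter> V\<^sub>4) = 1"
    and V\<^sub>2_independent: "w \<in> V\<^sub>2 \<Longrightarrow> neighbors G w \<inter> V\<^sub>2 = {}"
begin

lemma edge_sym: "u \<rightarrow>\<^bsub>G\<^esub> v \<Longrightarrow> v \<rightarrow>\<^bsub>G\<^esub> u"
  using arcs_ends_symmetric[OF sym_arcs] .

lemma finite_parts: "finite V\<^sub>4" "finite V\<^sub>2"
  using finite_verts verts_eq by auto

lemma d_in_verts: "d \<in> verts G"
  by (simp add: verts_eq)

lemma d_dominates: "v \<in> verts G \<Longrightarrow> v \<noteq> d \<Longrightarrow> d \<rightarrow>\<^bsub>G\<^esub> v"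
  using neighbors_d by (auto simp: neighbors_def)

lemma dominated_by_d: "v \<in> verts G \<Longrightarrow> v \<noteq> d \<Longrightarrow> v \<rightarrow>\<^bsub>G\<^esub> d"
  by (simp add: d_dominates edge_sym)

text \<open>Splits the neighbourhood into pieces whose sizes the locale assumptions give, in the
  shape that \<open>sum_null_weight_insert_d\<close> expects.\<close>

lemma neighbors_V\<^sub>4:
  assumes "u \<in> V\<^sub>4"
  shows "neighbors G u = insert d ((neighbors G u \<inter> V\<^sub>4) \<union> (neighbors G u \<inter> V\<^sub>2))"
  using assms neighbors_subset_verts[of u] dominated_by_d[of u] d_notin
  by (auto simp: verts_eq edge_iff_neighbors)

lemma neighbors_V\<^sub>2:
  assumes "w \<in> V\<^sub>2"
  shows "neighbors G w = insert d (neighbors G w \<inter> V\<^sub>4)"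
  using assms neighbors_subset_verts[of w] dominated_by_d[of w] d_notin V\<^sub>2_independent[of w]
  by (auto simp: verts_eq edge_iff_neighbors)

section \<open>The null vector as a weight on vertices\<close>

definition null_weight :: "'a \<Rightarrow> real" where
  "null_weight v = (if v \<in> V\<^sub>4 then - 1 else 1)"

lemma sum_null_weight_subset:
  "A \<subseteq> V\<^sub>4 \<Longrightarrow> sum null_weight A = - real (card A)"
  "B \<subseteq> V\<^sub>2 \<Longrightarrow> sum null_weight B = real (card B)"
proof -
  show "sum null_weight A = - real (card A)" if "A \<subseteq> V\<^sub>4"
  proof -
    have "sum null_weight A = (\<Sum>a\<in>A. - 1)"
      using that by (intro sum.cong) (auto simp: null_weight_def)
    then show ?thesis by simp
  qed
  show "sum null_weight B = real (card B)" if "B \<subseteq> V\<^sub>2"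
  proof -
    have "sum null_weight B = (\<Sum>b\<in>B. 1)"
      using that disjoint by (intro sum.cong) (auto simp: null_weight_def)
    then show ?thesis by simp
  qed
qed

lemma sum_null_weight_parts:
  assumes "A \<subseteq> V\<^sub>4" "B \<subseteq> V\<^sub>2"
  shows "sum null_weight (A \<union> B) = real (card B) - real (card A)"
proof -
  have "finite A" "finite B" "A \<inter> B = {}"
    using assms finite_parts disjoint finite_subset by blast+
  then show ?thesis
    using assms by (simp add: sum.union_disjoint sum_null_weight_subset)
qed

text \<open>The summand 1 is the weight of \<open>d\<close>. This shape covers the neighbourhoods of
  all vertices other than \<open>d\<close>, and also the whole vertex set.\<close>

lemma sum_null_weight_insert_d:
  assumes "A \<subseteq> V\<^sub>4" "B \<subseteq> V\<^sub>2"
  shows "sum null_weight (insert d (A \<union> B)) = 1 + real (card B) - real (card A)"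
proof -
  have "finite (A \<union> B)" "d \<notin> A \<union> B"
    using assms finite_parts d_notin by (auto dest: finite_subset)
  then show ?thesis
    using sum_null_weight_parts[OF assms] d_notin by (simp add: null_weight_def)
qed

lemma sum_null_weight_neighbors:
  assumes "u \<in> verts G"
  shows "sum null_weight (neighbors G u) = 0"
proof -
  consider "u = d" | "u \<in> V\<^sub>4" | "u \<in> V\<^sub>2"
    using assms verts_eq by blast
  then show ?thesis
  proof cases
    case 1
    have "neighbors G d = V\<^sub>4 \<union> V\<^sub>2"
      using neighbors_d verts_eq d_notin by auto
    with 1 show ?thesis
      by (simp add: sum_null_weight_parts card_parts)
  next
    case 2
    show ?thesis
      by (subst neighbors_V\<^sub>4[OF 2], subst sum_null_weight_insert_d)
        (simp_all add: card_neighbors_V\<^sub>4[OF 2])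
  next
    case 3
    show ?thesis
      \<comment> \<open>By independence of \<open>V\<^sub>2\<close> the second part of the
        neighbourhood is empty.\<close>
      using sum_null_weight_insert_d[of "neighbors G u \<inter> V\<^sub>4" "{}"]
      by (subst neighbors_V\<^sub>2[OF 3]) (simp add: card_neighbors_V\<^sub>2[OF 3])
  qed
qed

lemma sum_null_weight_verts: "sum null_weight (verts G) = 1"
  using sum_null_weight_insert_d[of V\<^sub>4 V\<^sub>2] by (simp add: verts_eq card_parts)

lemma core: "core_graph G"
  by (rule core_graphI[OF _ sum_null_weight_neighbors]) (auto simp: null_weight_def)

lemma zero_main_eigenvalue:
  "vertex_enumeration G vs \<Longrightarrow> main_eigenvalue (adjacency_matrix G vs) 0"
  by (rule main_eigenvalue_0I[OF _ sum_null_weight_neighbors]) (simp_all add: sum_null_weight_verts)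

section \<open>Triangles through the dominating vertex\<close>

lemma obtain_neighbor_V\<^sub>4:
  assumes "v \<in> verts G" "v \<noteq> d"
  obtains u where "u \<in> V\<^sub>4" "v \<rightarrow>\<^bsub>G\<^esub> u"
proof -
  have "card (neighbors G v \<inter> V\<^sub>4) \<noteq> 0"
    using assms verts_eq card_neighbors_V\<^sub>4(1) card_neighbors_V\<^sub>2 by auto
  then have "neighbors G v \<inter> V\<^sub>4 \<noteq> {}"
    by (metis card.empty)
  then show ?thesis
    using that by (auto simp: neighbors_def)
qed

lemma triangle_d:
  assumes "u \<rightarrow>\<^bsub>G\<^esub> v" "u \<noteq> d" "v \<noteq> d"
  shows "triangle G {u, v, d}"
  using assms adj_in_verts[OF assms(1)] by (intro triangleI dominated_by_d)

lemma d_in_triangle: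
  assumes "v \<in> verts G" "v \<noteq> d"
  obtains T where "triangle G T" "v \<in> T" "d \<in> T"
proof -
  obtain u where "u \<in> V\<^sub>4" "v \<rightarrow>\<^bsub>G\<^esub> u"
    using assms obtain_neighbor_V\<^sub>4 by blast
  then have "triangle G {v, u, d}"
    using assms d_notin by (intro triangle_d) auto
  then show ?thesis
    using that by blast
qed

text \<open>An edge avoiding \<open>d\<close> is completed by \<open>d\<close>. An edge at
  \<open>d\<close> is completed by a neighbour in \<open>V\<^sub>4\<close> of its other end.\<close>

lemma edge_in_triangle:
  assumes "u \<rightarrow>\<^bsub>G\<^esub> v"
  shows "\<exists>T. triangle G T \<and> u \<in> T \<and> v \<in> T"
proof (cases "u = d \<or> v = d")
  case True
  moreover have "u \<noteq> v"
    using assms adj_not_same by blast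
  ultimately show ?thesis
    using adj_in_verts[OF assms] by (metis d_in_triangle)
next
  case False
  then have "triangle G {u, v, d}"
    using assms by (intro triangle_d) auto
  then show ?thesis by blast
qed

lemma V\<^sub>2_nonempty: "V\<^sub>2 \<noteq> {}"
  using card_parts k_pos by auto

lemma vertex_in_triangle:
  assumes "u \<in> verts G"
  shows "\<exists>T. triangle G T \<and> u \<in> T"
proof -
  \<comment> \<open>The vertex \<open>w\<close> serves the case \<open>u = d\<close>: its triangle
    contains \<open>d\<close> as well.\<close>
  obtain w where "w \<in> V\<^sub>2"
    using V\<^sub>2_nonempty by blast
  then have "w \<in> verts G" "w \<noteq> d"
    using verts_eq d_notin by auto
  then show ?thesis
    using assms by (metis d_in_triangle)
qed

section \<open>Bipartiteness, regularity, connectedness and diameter\<close>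

lemma not_bipartite: "\<not> bipartite G"
  using vertex_in_triangle[OF d_in_verts] triangle_imp_not_bipartite by blast

text \<open>The vertex \<open>d\<close> has degree \<open>2 * k\<close>, while a vertex of
  \<open>V\<^sub>2\<close> has degree 2.\<close>

lemma not_regular:
  assumes "1 < k"
  shows "\<not> regular G"
proof
  assume "regular G"
  then obtain r where r: "\<And>v. v \<in> verts G \<Longrightarrow> card (neighbors G v) = r"
    unfolding regular_def out_degree_eq_card_neighbors by blast
  obtain w where w: "w \<in> V\<^sub>2"
    using V\<^sub>2_nonempty by blast
  have "neighbors G d = V\<^sub>4 \<union> V\<^sub>2"
    using neighbors_d verts_eq d_notin by auto
  then have "card (neighbors G d) = 2 * k"
    using finite_parts disjoint by (simp add: card_Un_disjoint card_parts)
  moreover have "card (neighbors G w) = 2"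
    using card_neighbors_V\<^sub>2[OF w] d_notin finite_parts
    by (subst neighbors_V\<^sub>2[OF w]) (simp add: card_insert_if)
  ultimately show False
    using r[of d] r[of w] w assms by (simp add: verts_eq)
qed

lemma connected: "Digraph_Component.connected G"
proof (rule connectedI)
  show "verts G \<noteq> {}"
    using d_in_verts by blast
  fix u v assume "u \<in> verts G" "v \<in> verts G"
  then have "u \<rightarrow>\<^sup>*\<^bsub>G\<^esub> d" "d \<rightarrow>\<^sup>*\<^bsub>G\<^esub> v"
    using d_dominates dominated_by_d by (metis reachable_adjI reachable_refl)+
  then show "u \<rightarrow>\<^sup>*\<^bsub>mk_symmetric G\<^esub> v"
    \<comment> \<open>Connectedness refers to the symmetric closure; the walk through
      \<open>d\<close> in \<open>G\<close> itself carries over to it.\<close>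
    by (intro reachable_mk_symmetricI) (rule reachable_trans)
qed

text \<open>If neither end is \<open>d\<close>, the walk through \<open>d\<close> has length two,
  even when \<open>u = v\<close>. Otherwise the empty walk or a single arc suffices.\<close>

lemma \<mu>_verts_le_2:
  assumes "u \<in> verts G" "v \<in> verts G"
  shows "\<mu> (\<lambda>_. 1) u v \<le> 2"
proof (cases "u = d \<or> v = d")
  case False
  then show ?thesis
    using assms by (intro \<mu>_le_2[of u d] d_dominates dominated_by_d) auto
next
  case True
  show ?thesis
  proof (cases "u = v")
    case True
    then have "awalk u [] v"
      using assms by (simp add: awalk_Nil_iff)
    from min_cost_le_walk_cost[OF this, of "\<lambda>_. 1"] have "\<mu> (\<lambda>_. 1) u v \<le> 0"
      by (simp add: zero_ereal_def)
    then show ?thesis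
      by (rule order_trans) simp
  next
    case False
    then have "u \<rightarrow>\<^bsub>G\<^esub> v"
      using \<open>u = d \<or> v = d\<close> assms d_dominates dominated_by_d by blast
    then have "\<mu> (\<lambda>_. 1) u v \<le> 1"
      by (rule \<mu>_le_1)
    then show ?thesis
      by (rule order_trans) simp
  qed
qed

lemma diameter:
  assumes "1 < k"
  shows "graph_diameter G = 2"
proof (rule antisym)
  show "graph_diameter G \<le> 2"
    unfolding graph_diameter_def by (intro SUP_least \<mu>_verts_le_2)
  \<comment> \<open>Two distinct vertices of \<open>V\<^sub>2\<close> exist because
    \<open>1 < k\<close>; being nonadjacent, they witness the lower bound for the nested
    suprema.\<close>
  obtain w w' where w: "w \<in> V\<^sub>2" "w' \<in> V\<^sub>2" "w \<noteq> w'"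
    using assms card_parts(2) by (metis card_le_Suc0_iff_eq finite_parts(2) not_less One_nat_def)
  then have "\<not> w \<rightarrow>\<^bsub>G\<^esub> w'"
    using V\<^sub>2_independent[of w] by (auto simp: neighbors_def)
  then have "2 \<le> \<mu> (\<lambda>_. 1) w w'"
    using w by (intro \<mu>_ge_2)
  also have "\<dots> \<le> graph_diameter G"
    unfolding graph_diameter_def using w
    by (intro SUP_upper2[of w] SUP_upper2[of w']) (auto simp: verts_eq)
  finally show "2 \<le> graph_diameter G" .
qed

end

section \<open>From the predicate \<open>satellite_graph\<close> to the locale\<close>

lemma satellite_graphE:
  assumes "satellite_graph k G" "0 < k"
  obtains d V\<^sub>4 V\<^sub>2 where "satellite G k d V\<^sub>4 V\<^sub>2"
  using assms unfolding satellite_graph_def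
  apply (elim conjE exE)
  subgoal for d V\<^sub>4 V\<^sub>2
    by (rule that[of d V\<^sub>4 V\<^sub>2]) (simp add: satellite_def satellite_axioms_def)
  done

theorem theorem4p3:
  fixes k :: nat and G :: "('a, 'b) pre_digraph"
  assumes "k \<ge> 3" and "satellite_graph k G"
  shows "core_graph G \<and>
    (\<forall>vs. vertex_enumeration G vs \<longrightarrow> main_eigenvalue (adjacency_matrix G vs) 0) \<and>
    (\<forall>u\<in>verts G. \<exists>T. triangle G T \<and> u \<in> T) \<and>
    (\<forall>u\<in>verts G. \<forall>w\<in>neighbors G u. \<exists>T. triangle G T \<and> u \<in> T \<and> w \<in> T) \<and>
    \<not> regular G \<and>
    Digraph_Component.connected G \<and>
    \<not> bipartite G \<and>
    graph_diameter G \<in> {2, 3}"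
proof -
  have "0 < k" "1 < k"
    using assms(1) by auto
  then obtain d V\<^sub>4 V\<^sub>2 where "satellite G k d V\<^sub>4 V\<^sub>2"
    using assms(2) satellite_graphE by blast
  then interpret satellite G k d V\<^sub>4 V\<^sub>2 .
  \<comment> \<open>The membership in \<open>{2, 3}\<close> follows from the exact value 2.\<close>
  show ?thesis
    using core zero_main_eigenvalue vertex_in_triangle edge_in_triangle not_regular[OF \<open>1 < k\<close>]
      connected not_bipartite diameter[OF \<open>1 < k\<close>]
    by (simp add: edge_iff_neighbors)
qed

end
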